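(* Let $T>0$ and let $X$ be an $\mathbb{N}$-valued random variable with density $f:\mathbb{N}\to(0,\infty)$ with respect to $\pi_T$ satisfying $H(X|\pi_T)<\infty$. Then the equality $$H(T_a(X)|\pi_{aT})=a\,H(X|\pi_T)$$ holds for some $a\in(0,1)$ if and only if there exist $\beta,\gamma\in\mathbb{R}$ such that $f(k)=e^{\beta k+\gamma}$ for all $k\in\mathbb{N}$ (that is, $X$ is Poisson distributed).
   Context: $\mathbb{N}=\{0,1,2,\dots\}$. For $T>0$, $\pi_T(k)=e^{-T}T^k/k!$ is the Poisson measure on $\mathbb{N}$. "$X$ has density $f$ with respect to $\pi_T$" means $\mathbb{P}(X=k)=f(k)\pi_T(k)$ for all $k$. For $a\in[0,1]$ the $a$-thinning of $X$ is $T_a(X):=\sum_{i=1}^X B_i$, where $(B_i)_{i\ge1}$ are i.i.d. Bernoulli random variables with $\mathbb{P}(B_i=1)=a$, independent of $X$. If $Y$ has density $g$ with respect to $\pi_t$, the relative entropy is $H(Y|\pi_t)=\sum_k g(k)\log(g(k))\,\pi_t(k)$, with $0\log0=0$. *)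

theory Defs
  imports "HOL-Probability.Probability"
begin

definition has_poisson_density ::
    "'w measure \<Rightarrow> ('w \<Rightarrow> nat) \<Rightarrow> real \<Rightarrow> (nat \<Rightarrow> real) \<Rightarrow> bool" where
  "has_poisson_density M Y t g \<longleftrightarrow>
     (\<forall>k. measure M {\<omega> \<in> space M. Y \<omega> = k} = g k * pmf (poisson_pmf t) k)"

text \<open>For \<open>t > 0\<close> the density exists and is unique, because every point of \<open>\<nat>\<close> has positive
  \<open>poisson_pmf t\<close>-mass.\<close>

definition poisson_density :: "'w measure \<Rightarrow> ('w \<Rightarrow> nat) \<Rightarrow> real \<Rightarrow> nat \<Rightarrow> real" where
  "poisson_density M Y t k = measure M {\<omega> \<in> space M. Y \<omega> = k} / pmf (poisson_pmf t) k"

lemma has_poisson_density_iff: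
  assumes "t > 0"
  shows "has_poisson_density M Y t g \<longleftrightarrow> g = poisson_density M Y t"
  using assms by (auto simp: has_poisson_density_def poisson_density_def fun_eq_iff field_simps)

text \<open>The summands are bounded below by \<open>- exp (-1) * pmf (poisson_pmf t) k\<close>, which is summable;
  hence the series either converges absolutely or diverges to \<open>\<infinity>\<close>.
  Since \<open>0 * ln 0 = 0\<close> here, no case distinction is needed at zeros of the density.\<close>

definition rel_entropy :: "'w measure \<Rightarrow> ('w \<Rightarrow> nat) \<Rightarrow> real \<Rightarrow> ereal" where
  "rel_entropy M Y t =
     (let h = (\<lambda>k. poisson_density M Y t k * ln (poisson_density M Y t k) * pmf (poisson_pmf t) k)
      in if summable h then ereal (\<Sum>k. h k) else \<infinity>)"

text \<open>The variables \<open>B\<^sub>i\<close> are realised as the coordinates of an infinite product of Bernoulli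
  measures; taking the product of \<open>M\<close> with it makes them independent of every random
  variable on \<open>M\<close>. Lemma \<open>distr_thinning\<close> below shows that the law of the thinning does not
  depend on this choice.\<close>

definition bernoulli_process :: "real \<Rightarrow> (nat \<Rightarrow> bool) measure" where
  "bernoulli_process a = (\<Pi>\<^sub>M i\<in>(UNIV :: nat set). measure_pmf (bernoulli_pmf a))"

definition thinning_space :: "'w measure \<Rightarrow> real \<Rightarrow> ('w \<times> (nat \<Rightarrow> bool)) measure" where
  "thinning_space M a = M \<Otimes>\<^sub>M bernoulli_process a"

definition thinning :: "('w \<Rightarrow> nat) \<Rightarrow> 'w \<times> (nat \<Rightarrow> bool) \<Rightarrow> nat" where
  "thinning X = (\<lambda>(\<omega>, b). \<Sum>i = 1..X \<omega>. of_bool (b i))"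

lemma prob_space_bernoulli_process: "prob_space (bernoulli_process a)"
  unfolding bernoulli_process_def by (intro prob_space_PiM measure_pmf.prob_space_axioms)

lemma prob_space_thinning_space:
  assumes "prob_space M"
  shows "prob_space (thinning_space M a)"
proof -
  interpret M: prob_space M by fact
  interpret P: prob_space "bernoulli_process a" by (rule prob_space_bernoulli_process)
  interpret MP: pair_prob_space M "bernoulli_process a" ..
  show ?thesis unfolding thinning_space_def by (rule MP.prob_space_axioms)
qed

lemma sets_bernoulli_process:
  "sets (bernoulli_process a) = sets (\<Pi>\<^sub>M i\<in>(UNIV :: nat set). count_space (UNIV :: bool set))"
  unfolding bernoulli_process_def by (intro sets_PiM_cong) simp_all

lemma measurable_thinning_id:
  "thinning (\<lambda>n. n) \<in> count_space UNIV \<Otimes>\<^sub>M (\<Pi>\<^sub>M i\<in>(UNIV :: nat set). count_space (UNIV :: bool set))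
     \<rightarrow>\<^sub>M count_space UNIV"
proof -
  let ?P = "\<Pi>\<^sub>M i\<in>(UNIV :: nat set). count_space (UNIV :: bool set)"
  have c: "(\<lambda>x. of_bool (snd x i) :: nat) \<in> count_space (UNIV :: nat set) \<Otimes>\<^sub>M ?P \<rightarrow>\<^sub>M count_space UNIV" for i
    by measurable
  have "(\<lambda>x. \<Sum>i = 1..n. of_bool (snd x i) :: nat) \<in> count_space (UNIV :: nat set) \<Otimes>\<^sub>M ?P \<rightarrow>\<^sub>M count_space UNIV"
    for n
    using c by measurable
  then have "(\<lambda>x. (\<lambda>n x. \<Sum>i = 1..n. of_bool (snd x i) :: nat) (fst x) x)
      \<in> count_space (UNIV :: nat set) \<Otimes>\<^sub>M ?P \<rightarrow>\<^sub>M count_space UNIV"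
    by (rule measurable_compose_countable) measurable
  then show ?thesis by (simp add: thinning_def case_prod_beta')
qed

lemma distr_thinning:
  fixes X :: "'w \<Rightarrow> nat" and B :: "nat \<Rightarrow> 'w \<Rightarrow> bool"
  assumes "prob_space M"
    and X: "X \<in> M \<rightarrow>\<^sub>M count_space UNIV"
    and iid: "prob_space.indep_vars M (\<lambda>_. count_space UNIV) B UNIV"
             "\<And>i. distr M (count_space UNIV) (B i) = measure_pmf (bernoulli_pmf a)"
    and indep: "prob_space.indep_set M
                  (sets (vimage_algebra (space M) X (count_space UNIV)))
                  (sets (vimage_algebra (space M) (\<lambda>\<omega> i. B i \<omega>)
                     (\<Pi>\<^sub>M i\<in>(UNIV :: nat set). count_space UNIV)))"
  shows "distr M (count_space UNIV) (\<lambda>\<omega>. \<Sum>i = 1..X \<omega>. of_bool (B i \<omega>)) =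
         distr (thinning_space M a) (count_space UNIV) (thinning X)"
proof -
  interpret prob_space M by fact
  interpret P: prob_space "bernoulli_process a" by (rule prob_space_bernoulli_process)
  let ?N = "count_space (UNIV :: nat set)"
  let ?P = "\<Pi>\<^sub>M i\<in>(UNIV :: nat set). count_space (UNIV :: bool set)"
  have B: "B i \<in> M \<rightarrow>\<^sub>M count_space UNIV" for i
    using iid(1) by (auto simp: indep_vars_def)
  have BB: "(\<lambda>\<omega> i. B i \<omega>) \<in> M \<rightarrow>\<^sub>M ?P"
    by (rule measurable_PiM_single') (use B in \<open>auto simp: space_PiM\<close>)
  have law_B: "distr M ?P (\<lambda>\<omega> i. B i \<omega>) = bernoulli_process a"
    using indep_vars_iff_distr_eq_PiM[where I = UNIV and M' = "\<lambda>_. count_space UNIV" and X = B] iid B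
    by (simp add: bernoulli_process_def restrict_def)
  have "distr M (count_space UNIV) (\<lambda>\<omega>. \<Sum>i = 1..X \<omega>. of_bool (B i \<omega>)) =
        distr (distr M (?N \<Otimes>\<^sub>M ?P) (\<lambda>\<omega>. (X \<omega>, \<lambda>i. B i \<omega>))) (count_space UNIV) (thinning (\<lambda>n. n))"
    using X BB by (subst distr_distr[OF measurable_thinning_id]) (auto simp: thinning_def comp_def)
  also have "distr M (?N \<Otimes>\<^sub>M ?P) (\<lambda>\<omega>. (X \<omega>, \<lambda>i. B i \<omega>)) = distr M ?N X \<Otimes>\<^sub>M bernoulli_process a"
  proof (rule pair_measure_eqI[symmetric])
    show "sigma_finite_measure (distr M ?N X)"
      using X by (intro prob_space_imp_sigma_finite prob_space_distr)
    show "sigma_finite_measure (bernoulli_process a)"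
      by (intro prob_space_imp_sigma_finite prob_space_bernoulli_process)
    show "sets (distr M ?N X \<Otimes>\<^sub>M bernoulli_process a) =
          sets (distr M (?N \<Otimes>\<^sub>M ?P) (\<lambda>\<omega>. (X \<omega>, \<lambda>i. B i \<omega>)))"
      unfolding sets_distr by (intro sets_pair_measure_cong sets_bernoulli_process) simp
  next
    fix U V assume UV: "U \<in> sets (distr M ?N X)" "V \<in> sets (bernoulli_process a)"
    then have V: "V \<in> sets ?P" by (simp add: sets_bernoulli_process)
    let ?U = "X -` U \<inter> space M" and ?V = "(\<lambda>\<omega> i. B i \<omega>) -` V \<inter> space M"
    have "prob (?U \<inter> ?V) = prob ?U * prob ?V"
      by (rule indep_setD[OF indep]) (use V in \<open>auto intro!: in_vimage_algebra\<close>)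
    then have *: "emeasure M (?U \<inter> ?V) = emeasure M ?U * emeasure M ?V"
      by (simp add: emeasure_eq_measure ennreal_mult)
    have XB: "(\<lambda>\<omega>. (X \<omega>, \<lambda>i. B i \<omega>)) \<in> M \<rightarrow>\<^sub>M ?N \<Otimes>\<^sub>M ?P"
      using X BB by (rule measurable_Pair)
    have "(\<lambda>\<omega>. (X \<omega>, \<lambda>i. B i \<omega>)) -` (U \<times> V) \<inter> space M = ?U \<inter> ?V" by auto
    then show "emeasure (distr M ?N X) U * emeasure (bernoulli_process a) V =
          emeasure (distr M (?N \<Otimes>\<^sub>M ?P) (\<lambda>\<omega>. (X \<omega>, \<lambda>i. B i \<omega>))) (U \<times> V)"
      unfolding law_B[symmetric] using V X BB XB *
      by (simp add: emeasure_distr)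
  qed
  also have "\<dots> = distr M ?N X \<Otimes>\<^sub>M distr (bernoulli_process a) ?P (\<lambda>b. b)"
    using distr_id2[OF sets_bernoulli_process[symmetric]] by (simp add: id_def)
  also have "\<dots> = distr (thinning_space M a) (?N \<Otimes>\<^sub>M ?P) (\<lambda>(\<omega>, b). (X \<omega>, b))"
    unfolding thinning_space_def
    by (intro pair_measure_distr X prob_space_imp_sigma_finite P.prob_space_distr
          measurable_ident_sets sets_bernoulli_process)
  also have "distr \<dots> (count_space UNIV) (thinning (\<lambda>n. n)) =
             distr (thinning_space M a) (count_space UNIV) (thinning X)"
  proof (subst distr_distr[OF measurable_thinning_id])
    have [measurable]: "(\<lambda>b. b) \<in> bernoulli_process a \<rightarrow>\<^sub>M ?P"
      by (intro measurable_ident_sets sets_bernoulli_process)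
    note X[measurable]
    show "(\<lambda>(\<omega>, b). (X \<omega>, b)) \<in> thinning_space M a \<rightarrow>\<^sub>M ?N \<Otimes>\<^sub>M ?P"
      unfolding thinning_space_def by measurable
  qed (simp add: thinning_def comp_def case_prod_beta')
  finally show ?thesis .
qed

end

theory Submission
  imports Defs
begin

text \<open>If \<open>X\<close> has law \<open>\<pi>\<^sub>T\<close>, the thinning \<open>U = T\<^sub>a X\<close> and the rest \<open>V = X - U\<close> are independent Poisson
  variables, so in general \<open>(U, V)\<close> has density \<open>f (u + v)\<close> with respect to \<open>\<pi>\<^bsub>aT\<^esub> \<otimes> \<pi>\<^bsub>(1-a)T\<^esub>\<close>, and \<open>T\<^sub>a X\<close> has
  density \<open>j \<mapsto> E f (j + N)\<close> with \<open>N\<close> Poisson of mean \<open>(1 - a) T\<close>. Superadditivity of relative entropy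
  over product reference measures, applied conditionally on a third Poisson component, says that
  \<open>\<phi> a = H(T\<^sub>a X | \<pi>\<^bsub>aT\<^esub>)\<close> is midpoint convex. Since \<open>\<phi> \<le> \<phi> 1 < \<infinity>\<close> it is convex, and \<open>\<phi> 0 = 0\<close>; hence
  \<open>\<phi> a = a \<phi> 1\<close> for a single \<open>a \<in> (0, 1)\<close> forces \<open>2 \<phi> (1/2) = \<phi> 1\<close>. This is the equality case of
  superadditivity for the two halves of \<open>X\<close>: they are independent, i.e. \<open>f (u + v) = g u * g v\<close>,
  which holds exactly for log-linear \<open>f\<close>.\<close>

subsection \<open>Superadditivity of relative entropy\<close>

text \<open>This is \<open>ln z \<le> z - 1\<close> at \<open>z = y / x\<close> with its equality
  case \<open>z = 1\<close>: the pointwise form of Gibbs' inequality.\<close>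

lemma xlnx_diff_ge:
  fixes x y :: real
  assumes "x > 0" "y > 0"
  shows "x - y \<le> x * (ln x - ln y)"
    and "x * (ln x - ln y) = x - y \<longleftrightarrow> x = y"
proof -
  have *: "x * (ln x - ln y) = - x * ln (y / x)" "x - y = - x * (y / x - 1)"
    using assms by (simp_all add: ln_div field_simps)
  show "x - y \<le> x * (ln x - ln y)"
    unfolding * using ln_le_minus_one[of "y / x"] assms by (simp add: mult_left_mono)
  have "ln (y / x) = y / x - 1 \<longleftrightarrow> y / x = 1"
    using ln_eq_minus_one[of "y / x"] assms by auto
  then show "x * (ln x - ln y) = x - y \<longleftrightarrow> x = y"
    unfolding * using assms by auto
qed

lemma xlnx_ge: "(x::real) > 0 \<Longrightarrow> x - 1 \<le> x * ln x"
  using xlnx_diff_ge(1)[of x 1] by simp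

lemma (in prob_space) expectation_pos:
  fixes h :: "'a \<Rightarrow> real"
  assumes "integrable M h" "\<And>x. x \<in> space M \<Longrightarrow> h x > 0"
  shows "expectation h > 0"
proof -
  have "expectation h \<noteq> 0"
  proof
    assume "expectation h = 0"
    then have "AE x in M. h x = 0"
      using assms by (subst (asm) integral_nonneg_eq_0_iff_AE) (auto intro!: AE_I2 less_imp_le)
    then have "AE x in M. False"
      using AE_space by eventually_elim (use assms(2) in fastforce)
    then show False by simp
  qed
  moreover have "expectation h \<ge> 0"
    using assms(2) by (intro integral_nonneg_AE AE_I2 less_imp_le)
  ultimately show ?thesis by simp
qed

text \<open>Jensen's inequality for \<open>x ln x\<close>, obtained by integrating the tangent line
  at the mean.\<close>

lemma (in prob_space) xlnx_expectation_le:
  fixes h :: "'a \<Rightarrow> real"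
  assumes "integrable M h" "integrable M (\<lambda>x. h x * ln (h x))" "\<And>x. x \<in> space M \<Longrightarrow> h x > 0"
  shows "expectation h * ln (expectation h) \<le> expectation (\<lambda>x. h x * ln (h x))"
proof -
  let ?m = "expectation h"
  have "?m > 0" using assms by (intro expectation_pos)
  then have "expectation (\<lambda>x. h x * ln ?m + h x - ?m) \<le> expectation (\<lambda>x. h x * ln (h x))"
    using assms xlnx_diff_ge(1)[of "h _" ?m] by (intro integral_mono) (auto simp: algebra_simps)
  then show ?thesis using assms by (simp add: prob_space)
qed

context pair_prob_space
begin

context
  fixes F :: "'a \<times> 'b \<Rightarrow> real"
  assumes F: "integrable (M1 \<Otimes>\<^sub>M M2) F"
    and F_xlnx: "integrable (M1 \<Otimes>\<^sub>M M2) (\<lambda>z. F z * ln (F z))"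
    and F_pos: "\<And>z. z \<in> space (M1 \<Otimes>\<^sub>M M2) \<Longrightarrow> F z > 0"
begin

text \<open>Only almost everywhere: on a null set the slice of \<open>F\<close> may fail to be
  integrable, and its Bochner integral is then 0.\<close>

lemma AE_marginal_pos: "AE x in M1. (\<integral>y. F (x, y) \<partial>M2) > 0"
  using AE_integrable_fst'[OF F] AE_space
  by eventually_elim (auto intro!: M2.expectation_pos F_pos simp: space_pair_measure)

lemma integrable_xlnx_marginal:
    "integrable M1 (\<lambda>x. (\<integral>y. F (x, y) \<partial>M2) * ln (\<integral>y. F (x, y) \<partial>M2))" (is ?I)
  and xlnx_marginal_le:
    "(\<integral>x. (\<integral>y. F (x, y) \<partial>M2) * ln (\<integral>y. F (x, y) \<partial>M2) \<partial>M1) \<le>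
     (\<integral>z. F z * ln (F z) \<partial>(M1 \<Otimes>\<^sub>M M2))" (is ?L)
proof -
  let ?G = "\<lambda>x. \<integral>y. F (x, y) \<partial>M2"
  let ?H = "\<lambda>x. \<integral>y. F (x, y) * ln (F (x, y)) \<partial>M2"
  note [measurable] = borel_measurable_integrable[OF F]
  have G: "integrable M1 ?G" by (rule integrable_fst'[OF F])
  have H: "integrable M1 ?H" by (rule integrable_fst'[OF F_xlnx])
  have le: "AE x in M1. ?G x * ln (?G x) \<le> ?H x"
    using AE_integrable_fst'[OF F] AE_integrable_fst'[OF F_xlnx] AE_space
    by eventually_elim (auto intro!: M2.xlnx_expectation_le F_pos simp: space_pair_measure)
  \<comment> \<open>\<open>?G x * ln (?G x)\<close> lies between \<open>?G x - 1\<close> and the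
    integrable \<open>?H x\<close>, which bounds its absolute value.\<close>
  have "AE x in M1. norm (?G x * ln (?G x)) \<le> norm (\<bar>?G x\<bar> + 1 + \<bar>?H x\<bar>)"
    using le AE_marginal_pos by eventually_elim (use xlnx_ge in \<open>smt (verit) real_norm_def\<close>)
  then show ?I
    by (rule Bochner_Integration.integrable_bound[rotated 2]) (use G H in auto)
  then have "(\<integral>x. ?G x * ln (?G x) \<partial>M1) \<le> (\<integral>x. ?H x \<partial>M1)"
    using H le by (rule integral_mono_AE)
  then show ?L using integral_fst'[OF F_xlnx] by simp
qed

text \<open>The logarithm depends on the first coordinate alone, so integrating over the second
  replaces \<open>F\<close> by its marginal. Positivity of \<open>F\<close> makes this work for
  absolute values too, which gives the integrability that Fubini requires.\<close>

lemma
  shows integrable_mult_ln_marginal: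
    "integrable (M1 \<Otimes>\<^sub>M M2) (\<lambda>z. F z * ln (\<integral>y. F (fst z, y) \<partial>M2))" (is ?I)
  and integral_mult_ln_marginal:
    "(\<integral>z. F z * ln (\<integral>y. F (fst z, y) \<partial>M2) \<partial>(M1 \<Otimes>\<^sub>M M2)) =
     (\<integral>x. (\<integral>y. F (x, y) \<partial>M2) * ln (\<integral>y. F (x, y) \<partial>M2) \<partial>M1)"
proof -
  let ?G = "\<lambda>x. \<integral>y. F (x, y) \<partial>M2"
  note [measurable] = borel_measurable_integrable[OF F]
  show ?I
  proof (rule Fubini_integrable)
    have "AE x in M1. \<bar>?G x * ln (?G x)\<bar> = (\<integral>y. norm (F (x, y) * ln (?G x)) \<partial>M2)"
      using AE_marginal_pos AE_space
    proof eventually_elim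
      case (elim x)
      have "(\<integral>y. norm (F (x, y) * ln (?G x)) \<partial>M2) = (\<integral>y. F (x, y) * \<bar>ln (?G x)\<bar> \<partial>M2)"
        using F_pos elim(2)
        by (intro Bochner_Integration.integral_cong) (auto simp: space_pair_measure abs_mult less_imp_le)
      then show ?case using elim(1) by (auto simp: abs_mult)
    qed
    then have "integrable M1 (\<lambda>x. \<bar>?G x * ln (?G x)\<bar>) \<longleftrightarrow>
        integrable M1 (\<lambda>x. \<integral>y. norm (F (x, y) * ln (?G x)) \<partial>M2)"
      by (intro integrable_cong_AE) auto
    then show "integrable M1 (\<lambda>x. \<integral>y. norm (F (x, y) * ln (\<integral>y'. F (fst (x, y), y') \<partial>M2)) \<partial>M2)"
      using integrable_xlnx_marginal by simp
    show "AE x in M1. integrable M2 (\<lambda>y. F (x, y) * ln (\<integral>y'. F (fst (x, y), y') \<partial>M2))"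
      using AE_integrable_fst'[OF F] by eventually_elim simp
  qed measurable
  from integral_fst'[OF this] show "(\<integral>z. F z * ln (?G (fst z)) \<partial>(M1 \<Otimes>\<^sub>M M2)) =
     (\<integral>x. ?G x * ln (?G x) \<partial>M1)"
    by simp
qed

end

text \<open>Gibbs' inequality for \<open>F\<close> against \<open>G1 \<otimes> G2 / m\<close>, which has the same total mass \<open>m\<close>.\<close>

lemma
  fixes F :: "'a \<times> 'b \<Rightarrow> real"
  assumes F: "integrable (M1 \<Otimes>\<^sub>M M2) F"
    and F_xlnx: "integrable (M1 \<Otimes>\<^sub>M M2) (\<lambda>z. F z * ln (F z))"
    and F_pos: "\<And>z. z \<in> space (M1 \<Otimes>\<^sub>M M2) \<Longrightarrow> F z > 0"
  defines "m \<equiv> \<integral>z. F z \<partial>(M1 \<Otimes>\<^sub>M M2)"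
    and "G1 \<equiv> \<lambda>x. \<integral>y. F (x, y) \<partial>M2"
    and "G2 \<equiv> \<lambda>y. \<integral>x. F (x, y) \<partial>M1"
  shows xlnx_superadditive:
      "(\<integral>x. G1 x * ln (G1 x) \<partial>M1) + (\<integral>y. G2 y * ln (G2 y) \<partial>M2) \<le>
       (\<integral>z. F z * ln (F z) \<partial>(M1 \<Otimes>\<^sub>M M2)) + m * ln m"
    and xlnx_superadditive_eq_iff:
      "(\<integral>x. G1 x * ln (G1 x) \<partial>M1) + (\<integral>y. G2 y * ln (G2 y) \<partial>M2) =
       (\<integral>z. F z * ln (F z) \<partial>(M1 \<Otimes>\<^sub>M M2)) + m * ln m \<longleftrightarrow>
       (AE z in M1 \<Otimes>\<^sub>M M2. F z * m = G1 (fst z) * G2 (snd z))"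
proof -
  let ?P = "M1 \<Otimes>\<^sub>M M2" and ?F' = "\<lambda>(y, x). F (x, y)"
  \<comment> \<open>The swapped product lets the facts about the first marginal be reused for
    \<open>G2\<close>.\<close>
  interpret S: pair_prob_space M2 M1 ..
  note [measurable] = borel_measurable_integrable[OF F]
  have F': "integrable (M2 \<Otimes>\<^sub>M M1) ?F'" "integrable (M2 \<Otimes>\<^sub>M M1) (\<lambda>z. ?F' z * ln (?F' z))"
      "\<And>z. z \<in> space (M2 \<Otimes>\<^sub>M M1) \<Longrightarrow> ?F' z > 0"
    using integrable_product_swap[OF F] integrable_product_swap[OF F_xlnx] F_pos
    by (auto simp: case_prod_unfold space_pair_measure)
  have m: "m > 0" unfolding m_def by (intro expectation_pos F F_pos)
  have G1: "integrable M1 G1" "integral\<^sup>L M1 G1 = m"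
    using integrable_fst'[OF F] integral_fst'[OF F] by (simp_all add: G1_def m_def)
  have "(\<integral>x. ?F' x \<partial>(M2 \<Otimes>\<^sub>M M1)) = m"
    unfolding m_def by (rule integral_product_swap) measurable
  then have G2: "integrable M2 G2" "integral\<^sup>L M2 G2 = m"
    using S.integrable_fst'[OF F'(1)] S.integral_fst'[OF F'(1)] by (simp_all add: G2_def)
  have l1: "integrable ?P (\<lambda>z. F z * ln (G1 (fst z)))"
      "(\<integral>z. F z * ln (G1 (fst z)) \<partial>?P) = (\<integral>x. G1 x * ln (G1 x) \<partial>M1)"
    using integrable_mult_ln_marginal[OF F F_xlnx F_pos] integral_mult_ln_marginal[OF F F_xlnx F_pos]
    unfolding G1_def by auto
  have l2: "integrable ?P (\<lambda>z. F z * ln (G2 (snd z)))"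
    using S.integrable_product_swap[OF S.integrable_mult_ln_marginal[OF F']]
    by (simp add: G2_def case_prod_unfold)
  have l2': "(\<integral>z. F z * ln (G2 (snd z)) \<partial>?P) = (\<integral>y. G2 y * ln (G2 y) \<partial>M2)"
  proof -
    have [measurable]: "G2 \<in> borel_measurable M2" using G2(1) by simp
    have "(\<integral>z. F z * ln (G2 (snd z)) \<partial>?P) = (\<integral>(y, x). F (x, y) * ln (G2 (snd (x, y))) \<partial>(M2 \<Otimes>\<^sub>M M1))"
      by (rule integral_product_swap[symmetric]) measurable
    then show ?thesis
      using S.integral_mult_ln_marginal[OF F'] by (simp add: G2_def case_prod_unfold)
  qed
  have [measurable]: "G1 \<in> borel_measurable M1" "G2 \<in> borel_measurable M2"
    using G1 G2 by auto
  have i: "integrable ?P (\<lambda>z. G1 (fst z) * G2 (snd z))"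
  proof (rule Fubini_integrable)
    have "(\<lambda>x. \<integral>y. norm (G1 (fst (x, y)) * G2 (snd (x, y))) \<partial>M2) = (\<lambda>x. \<bar>G1 x\<bar> * (\<integral>y. \<bar>G2 y\<bar> \<partial>M2))"
      by (simp add: abs_mult)
    then show "integrable M1 (\<lambda>x. \<integral>y. norm (G1 (fst (x, y)) * G2 (snd (x, y))) \<partial>M2)"
      using G1 by simp
  qed (use G2 in auto)
  have i': "(\<integral>z. G1 (fst z) * G2 (snd z) \<partial>?P) = m * m"
    using integral_fst'[OF i] G1 G2 by simp
  \<comment> \<open>\<open>D\<close> is the gap in \<open>xlnx_diff_ge\<close> between
    \<open>F\<close> and \<open>G1 G2 / m\<close>. The logarithms are kept apart so that each
    summand is integrable by itself; the correction \<open>F - G1 G2 / m\<close> integrates to 0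
    because both terms have mass \<open>m\<close>.\<close>
  define D where "D z = F z * (ln (F z) + ln m - ln (G1 (fst z)) - ln (G2 (snd z))) -
      (F z - G1 (fst z) * G2 (snd z) / m)" for z
  have D_alt: "D = (\<lambda>z. F z * ln (F z) + F z * ln m - F z * ln (G1 (fst z)) - F z * ln (G2 (snd z)) -
      (F z - G1 (fst z) * G2 (snd z) / m))"
    by (auto simp: D_def fun_eq_iff algebra_simps)
  have D: "integrable ?P D"
    unfolding D_alt using F F_xlnx l1(1) l2 i by auto
  have D_int: "(\<integral>z. D z \<partial>?P) = (\<integral>z. F z * ln (F z) \<partial>?P) + m * ln m -
      (\<integral>x. G1 x * ln (G1 x) \<partial>M1) - (\<integral>y. G2 y * ln (G2 y) \<partial>M2)"
    unfolding D_alt using F F_xlnx l1 l2 l2' i i' m by (simp add: m_def[symmetric])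
  have "AE z in ?P. G1 (fst z) > 0"
    using AE_marginal_pos[OF F F_xlnx F_pos] by (intro AE_pair_measure) (auto simp: G1_def)
  moreover have "AE z in ?P. G2 (snd z) > 0"
    using S.AE_marginal_pos[OF F'] by (intro AE_pair_measure) (auto simp: G2_def)
  ultimately have key: "AE z in ?P. D z \<ge> 0 \<and> (D z = 0 \<longleftrightarrow> F z * m = G1 (fst z) * G2 (snd z))"
    using AE_space
  proof eventually_elim
    case (elim z)
    let ?q = "G1 (fst z) * G2 (snd z) / m"
    have "?q > 0" using elim m by simp
    moreover have "D z = F z * (ln (F z) - ln ?q) - (F z - ?q)"
      using elim m by (simp add: D_def ln_mult ln_div algebra_simps)
    moreover have "F z > 0" using F_pos elim by simp
    moreover have "F z * m = G1 (fst z) * G2 (snd z) \<longleftrightarrow> F z = ?q"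
      using m by (simp add: field_simps)
    ultimately show ?case
      using xlnx_diff_ge[of "F z" ?q] by simp
  qed
  then have nonneg: "AE z in ?P. D z \<ge> 0" by auto
  then show "(\<integral>x. G1 x * ln (G1 x) \<partial>M1) + (\<integral>y. G2 y * ln (G2 y) \<partial>M2) \<le>
       (\<integral>z. F z * ln (F z) \<partial>?P) + m * ln m"
    using integral_nonneg_AE[OF nonneg] D_int by simp
  have "(\<integral>x. G1 x * ln (G1 x) \<partial>M1) + (\<integral>y. G2 y * ln (G2 y) \<partial>M2) =
       (\<integral>z. F z * ln (F z) \<partial>?P) + m * ln m \<longleftrightarrow> (AE z in ?P. D z = 0)"
    using integral_nonneg_eq_0_iff_AE[OF D nonneg] D_int by auto
  also have "\<dots> \<longleftrightarrow> (AE z in ?P. F z * m = G1 (fst z) * G2 (snd z))"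
    using key by (intro iffI) (auto elim: eventually_elim2)
  finally show "(\<integral>x. G1 x * ln (G1 x) \<partial>M1) + (\<integral>y. G2 y * ln (G2 y) \<partial>M2) =
       (\<integral>z. F z * ln (F z) \<partial>?P) + m * ln m \<longleftrightarrow>
       (AE z in ?P. F z * m = G1 (fst z) * G2 (snd z))" .
qed

end

subsection \<open>Poisson convolution\<close>

text \<open>On countable types the product sigma-algebra is the full power set, so comparing atoms
  suffices. This combines Fubini on the product with atomwise statements about a pmf.\<close>

lemma measure_pair_pmf:
  fixes A :: "'a :: countable pmf" and B :: "'b :: countable pmf"
  shows "measure_pmf A \<Otimes>\<^sub>M measure_pmf B = measure_pmf (pair_pmf A B)"
proof (rule measure_eqI_countable[where A = UNIV])
  have "sets (measure_pmf A \<Otimes>\<^sub>M measure_pmf B) =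
      sets (count_space (UNIV :: 'a set) \<Otimes>\<^sub>M count_space (UNIV :: 'b set))"
    by (intro sets_pair_measure_cong) simp_all
  then show "sets (measure_pmf A \<Otimes>\<^sub>M measure_pmf B) = Pow UNIV"
    by (simp only: pair_measure_countable[OF countableI_type countableI_type]) simp
  fix x :: "'a \<times> 'b"
  obtain a b where x: "x = (a, b)" by (cases x)
  have "emeasure (measure_pmf A \<Otimes>\<^sub>M measure_pmf B) ({a} \<times> {b}) = emeasure A {a} * emeasure B {b}"
    by (rule measure_pmf.emeasure_pair_measure_Times) simp_all
  then show "emeasure (measure_pmf A \<Otimes>\<^sub>M measure_pmf B) {x} = emeasure (measure_pmf (pair_pmf A B)) {x}"
    by (simp add: x emeasure_pmf_single pmf_pair ennreal_mult)
qed auto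

text \<open>\<open>poisson_pmf t\<close> is only specified for \<open>t > 0\<close>; the point mass at \<open>0\<close> makes the convolution rule
  cover \<open>t = 0\<close>.\<close>

definition poisson :: "real \<Rightarrow> nat pmf" where
  "poisson t = (if t > 0 then poisson_pmf t else return_pmf 0)"

lemma pmf_poisson': "t \<ge> 0 \<Longrightarrow> pmf (poisson t) k = t ^ k / fact k * exp (- t)"
  by (auto simp: poisson_def indicator_def)

lemma set_poisson: "t > 0 \<Longrightarrow> set_pmf (poisson t) = UNIV"
  by (simp add: poisson_def)

lemma poisson_0: "poisson 0 = return_pmf 0"
  by (simp add: poisson_def)

text \<open>The fibre of addition over \<open>k\<close> is a finite diagonal, and the binomial
  theorem sums the weights along it.\<close>

lemma poisson_add:
  assumes "s \<ge> 0" "t \<ge> 0"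
  shows "map_pmf (\<lambda>(u, v). u + v) (pair_pmf (poisson s) (poisson t)) = poisson (s + t)"
proof (rule pmf_eqI)
  fix k
  have "(\<lambda>(u, v). u + v :: nat) -` {k} = (\<lambda>i. (i, k - i)) ` {..k}"
    by (auto simp: image_iff)
  then have "pmf (map_pmf (\<lambda>(u, v). u + v) (pair_pmf (poisson s) (poisson t))) k =
      (\<Sum>i\<le>k. pmf (poisson s) i * pmf (poisson t) (k - i))"
    by (simp add: pmf_map measure_measure_pmf_finite sum.reindex inj_on_def pmf_pair)
  also have "\<dots> = (\<Sum>i\<le>k. of_nat (k choose i) * s ^ i * t ^ (k - i)) / fact k * exp (- (s + t))"
    using assms
    unfolding sum_divide_distrib sum_distrib_right
    by (intro sum.cong refl) (use assms in \<open>simp add: pmf_poisson' binomial_fact exp_diff exp_minus field_simps\<close>)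
  also have "\<dots> = pmf (poisson (s + t)) k"
    using assms by (simp add: pmf_poisson' binomial_ring)
  finally show "pmf (map_pmf (\<lambda>(u, v). u + v) (pair_pmf (poisson s) (poisson t))) k =
      pmf (poisson (s + t)) k" .
qed

lemma pair_prob_space_pmf: "pair_prob_space (measure_pmf A) (measure_pmf B)"
  by unfold_locales

lemma
  fixes h :: "nat \<Rightarrow> real"
  assumes "s \<ge> 0" "t \<ge> 0"
  shows integrable_poisson_add: "integrable (poisson s \<Otimes>\<^sub>M poisson t) (\<lambda>(u, v). h (u + v)) \<longleftrightarrow>
      integrable (poisson (s + t)) h"
    and integral_poisson_add: "(\<integral>(u, v). h (u + v) \<partial>(poisson s \<Otimes>\<^sub>M poisson t)) =
      measure_pmf.expectation (poisson (s + t)) h"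
  by (simp_all add: measure_pair_pmf flip: poisson_add[OF assms])
     (simp_all add: map_pmf_rep_eq integrable_distr_eq integral_distr case_prod_unfold)

text \<open>Fubini for \<open>h (u + v)\<close>. For a discrete law almost everywhere means at every
  atom, hence the restriction of \<open>u\<close> to \<open>set_pmf (poisson s)\<close>.\<close>

lemma
  fixes h :: "nat \<Rightarrow> real"
  assumes st: "s \<ge> 0" "t \<ge> 0" and h: "integrable (poisson (s + t)) h"
  shows integrable_poisson_shift: "u \<in> set_pmf (poisson s) \<Longrightarrow> integrable (poisson t) (\<lambda>v. h (u + v))"
    and integrable_poisson_avg:
      "integrable (poisson s) (\<lambda>u. measure_pmf.expectation (poisson t) (\<lambda>v. h (u + v)))"
    and integral_poisson_avg:
      "measure_pmf.expectation (poisson s) (\<lambda>u. measure_pmf.expectation (poisson t) (\<lambda>v. h (u + v))) =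
       measure_pmf.expectation (poisson (s + t)) h"
proof -
  interpret P: pair_prob_space "poisson s" "poisson t" by (rule pair_prob_space_pmf)
  have i: "integrable (poisson s \<Otimes>\<^sub>M poisson t) (\<lambda>(u, v). h (u + v))"
    using h st by (simp add: integrable_poisson_add)
  show "integrable (poisson t) (\<lambda>v. h (u + v))" if "u \<in> set_pmf (poisson s)"
    using P.AE_integrable_fst'[OF i] that by (simp add: AE_measure_pmf_iff)
  show "integrable (poisson s) (\<lambda>u. measure_pmf.expectation (poisson t) (\<lambda>v. h (u + v)))"
    using P.integrable_fst'[OF i] by simp
  show "measure_pmf.expectation (poisson s) (\<lambda>u. measure_pmf.expectation (poisson t) (\<lambda>v. h (u + v))) =
       measure_pmf.expectation (poisson (s + t)) h"
    using P.integral_fst'[OF i] st by (simp add: integral_poisson_add)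
qed

subsection \<open>The law of a thinning\<close>

lemma integrable_pmf_nat_iff:
  fixes h :: "nat \<Rightarrow> real"
  shows "integrable (measure_pmf p) h \<longleftrightarrow> summable (\<lambda>k. \<bar>pmf p k * h k\<bar>)"
  by (simp add: measure_pmf_eq_density integrable_density integrable_count_space_nat_iff)

lemma sums_pmf_expectation:
  fixes h :: "nat \<Rightarrow> real"
  assumes "integrable (measure_pmf p) h"
  shows "(\<lambda>k. pmf p k * h k) sums measure_pmf.expectation p h"
  using assms sums_integral_count_space_nat[of "\<lambda>k. pmf p k * h k"]
  by (simp add: measure_pmf_eq_density integrable_density integral_density)

text \<open>The sum sees only the coordinates \<open>1..n\<close>; restricted to them the infinite
  product is the law of \<open>Pi_pmf\<close>, whose number of successes is binomial. The case
  \<open>n = 0\<close> is split off because the product characterisation of independence is applied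
  to a nonempty index set.\<close>

lemma distr_sum_bernoulli_process:
  assumes a: "0 \<le> a" "a \<le> 1"
  shows "distr (bernoulli_process a) (count_space UNIV) (\<lambda>b. \<Sum>i = 1..n. of_bool (b i)) =
    measure_pmf (binomial_pmf n a)"
proof (cases "n = 0")
  case True
  interpret prob_space "bernoulli_process a" by (rule prob_space_bernoulli_process)
  show ?thesis
    using True a by (simp add: binomial_pmf_0 return_pmf.rep_eq)
next
  case False
  let ?J = "{1..n}" and ?B = "\<lambda>_ :: nat. measure_pmf (bernoulli_pmf a)"
  let ?pi = "Pi_pmf ?J False (\<lambda>_. bernoulli_pmf a)" and ?C = "Pi\<^sub>M {1..n} (\<lambda>_. count_space (UNIV :: bool set))"
  let ?S = "\<lambda>b :: nat \<Rightarrow> bool. \<Sum>i = 1..n. of_bool (b i) :: nat"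
  interpret P: product_prob_space ?B UNIV by unfold_locales
  have setsJ: "sets (Pi\<^sub>M ?J ?B) = sets ?C" by (intro sets_PiM_cong) simp_all
  have "(\<lambda>b. of_bool (b i) :: nat) \<in> ?C \<rightarrow>\<^sub>M count_space UNIV" if "i \<in> ?J" for i
    using that by measurable
  then have S: "?S \<in> ?C \<rightarrow>\<^sub>M count_space UNIV" by measurable
  have "distr ?pi ?C (\<lambda>b. restrict b ?J) = Pi\<^sub>M ?J (\<lambda>i. distr ?pi (count_space UNIV) (\<lambda>b. b i))"
    using False
    by (intro prob_space.indep_vars_iff_distr_eq_PiM'[OF measure_pmf.prob_space_axioms, THEN iffD1] indep_vars_Pi_pmf) auto
  also have "\<dots> = Pi\<^sub>M ?J ?B"
    by (intro PiM_cong refl) (simp add: Pi_pmf_component flip: map_pmf_rep_eq)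
  also have "\<dots> = distr (bernoulli_process a) (Pi\<^sub>M ?J ?B) (\<lambda>b. restrict b ?J)"
    unfolding bernoulli_process_def by (rule P.distr_PiM_restrict_finite[symmetric]) auto
  also have "\<dots> = distr (bernoulli_process a) ?C (\<lambda>b. restrict b ?J)"
    by (rule distr_cong[OF refl setsJ]) simp
  finally have eq: "distr (bernoulli_process a) ?C (\<lambda>b. restrict b ?J) = distr ?pi ?C (\<lambda>b. restrict b ?J)" ..
  have r: "(\<lambda>b. restrict b ?J) \<in> bernoulli_process a \<rightarrow>\<^sub>M ?C"
    unfolding measurable_cong_sets[OF sets_bernoulli_process refl]
    by (rule measurable_restrict_subset) simp
  have r': "(\<lambda>b. restrict b ?J) \<in> ?pi \<rightarrow>\<^sub>M ?C"
    by (simp add: space_PiM)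
  have S_restrict: "?S \<circ> (\<lambda>b. restrict b ?J) = ?S"
    by (auto simp: fun_eq_iff simp del: sum_of_bool_eq intro!: sum.cong)
  have "distr (bernoulli_process a) (count_space UNIV) ?S =
      distr (distr (bernoulli_process a) ?C (\<lambda>b. restrict b ?J)) (count_space UNIV) ?S"
    unfolding distr_distr[OF S r] S_restrict ..
  also have "\<dots> = distr ?pi (count_space UNIV) ?S"
    unfolding eq distr_distr[OF S r'] S_restrict ..
  also have "\<dots> = measure_pmf (map_pmf (\<lambda>b. card {i \<in> ?J. b i}) ?pi)"
    by (simp add: map_pmf_rep_eq sum_of_bool_eq Int_def)
  also have "map_pmf (\<lambda>b. card {i \<in> ?J. b i}) ?pi = binomial_pmf n a"
    using a by (intro binomial_pmf_altdef'[symmetric]) auto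
  finally show ?thesis .
qed

lemma measurable_thinning:
  assumes X: "X \<in> M \<rightarrow>\<^sub>M count_space UNIV"
  shows "thinning X \<in> thinning_space M a \<rightarrow>\<^sub>M count_space UNIV"
proof -
  let ?P = "\<Pi>\<^sub>M i\<in>(UNIV :: nat set). count_space (UNIV :: bool set)"
  have [measurable]: "(\<lambda>b. b) \<in> bernoulli_process a \<rightarrow>\<^sub>M ?P"
    by (intro measurable_ident_sets sets_bernoulli_process)
  note X[measurable]
  have "(\<lambda>(\<omega>, b). (X \<omega>, b)) \<in> thinning_space M a \<rightarrow>\<^sub>M count_space UNIV \<Otimes>\<^sub>M ?P"
    unfolding thinning_space_def by measurable
  from measurable_compose[OF this measurable_thinning_id] show ?thesis
    by (simp add: thinning_def case_prod_unfold)
qed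

text \<open>Fubini: with \<open>\<omega>\<close> fixed, the thinning is a sum of
  \<open>X \<omega>\<close> independent Bernoulli variables.\<close>

lemma measure_thinning_eq:
  assumes "prob_space M" and X: "X \<in> M \<rightarrow>\<^sub>M count_space UNIV" and a: "0 \<le> a" "a \<le> 1"
  shows "measure (thinning_space M a) {z \<in> space (thinning_space M a). thinning X z = j} =
    (\<integral>\<omega>. pmf (binomial_pmf (X \<omega>) a) j \<partial>M)"
proof -
  interpret M: prob_space M by fact
  interpret B: prob_space "bernoulli_process a" by (rule prob_space_bernoulli_process)
  interpret T: prob_space "thinning_space M a" by (rule prob_space_thinning_space) fact
  let ?A = "{z \<in> space (thinning_space M a). thinning X z = j}"
  have A: "?A \<in> sets (thinning_space M a)"
    using measurable_thinning[OF X] by (rule measurable_sets_Collect) simp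
  have slice: "emeasure (bernoulli_process a) (Pair \<omega> -` ?A) = ennreal (pmf (binomial_pmf (X \<omega>) a) j)"
    if "\<omega> \<in> space M" for \<omega>
  proof -
    let ?S = "\<lambda>b :: nat \<Rightarrow> bool. \<Sum>i = 1..X \<omega>. of_bool (b i) :: nat"
    have "(\<lambda>b. of_bool (b i) :: nat) \<in> bernoulli_process a \<rightarrow>\<^sub>M count_space UNIV" for i
      unfolding bernoulli_process_def by measurable
    then have S: "?S \<in> bernoulli_process a \<rightarrow>\<^sub>M count_space UNIV" by measurable
    have "Pair \<omega> -` ?A = ?S -` {j} \<inter> space (bernoulli_process a)"
      using that by (auto simp: thinning_def thinning_space_def space_pair_measure)
    also have "emeasure (bernoulli_process a) \<dots> =
        emeasure (distr (bernoulli_process a) (count_space UNIV) ?S) {j}"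
      using S by (simp add: emeasure_distr)
    finally show ?thesis
      by (simp only: distr_sum_bernoulli_process[OF a]) (simp add: emeasure_pmf_single)
  qed
  have X': "(\<lambda>\<omega>. pmf (binomial_pmf (X \<omega>) a) j) \<in> borel_measurable M"
    by (rule measurable_compose[OF X]) simp
  have "ennreal (measure (thinning_space M a) ?A) = emeasure (thinning_space M a) ?A"
    by (simp add: T.emeasure_eq_measure)
  also have "\<dots> = (\<integral>\<^sup>+\<omega>. emeasure (bernoulli_process a) (Pair \<omega> -` ?A) \<partial>M)"
    using B.emeasure_pair_measure_alt[OF A[unfolded thinning_space_def]]
    unfolding thinning_space_def .
  also have "\<dots> = (\<integral>\<^sup>+\<omega>. ennreal (pmf (binomial_pmf (X \<omega>) a) j) \<partial>M)"
    by (intro nn_integral_cong slice)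
  also have "\<dots> = ennreal (\<integral>\<omega>. pmf (binomial_pmf (X \<omega>) a) j \<partial>M)"
    using X' by (intro nn_integral_eq_integral M.integrable_const_bound[where B = 1]) (auto simp: pmf_le_1)
  finally show ?thesis by simp
qed

lemma distr_eq_density_poisson:
  assumes "prob_space M" and X: "X \<in> M \<rightarrow>\<^sub>M count_space UNIV" and f: "has_poisson_density M X t f"
    and pos: "\<And>k. f k \<ge> 0"
  shows "distr M (count_space UNIV) X = density (measure_pmf (poisson_pmf t)) f"
proof (rule measure_eqI_countable[where A = UNIV])
  interpret prob_space M by fact
  fix k
  have "X -` {k} \<inter> space M = {\<omega> \<in> space M. X \<omega> = k}" by auto
  moreover have "emeasure (density (poisson_pmf t) f) {k} = ennreal (f k * pmf (poisson_pmf t) k)"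
    using pos by (simp add: emeasure_density nn_integral_pmf' ennreal_mult emeasure_pmf_single nn_integral_cmult_indicator)
  ultimately show "emeasure (distr M (count_space UNIV) X) {k} = emeasure (density (poisson_pmf t) f) {k}"
    using f X by (simp add: emeasure_distr emeasure_eq_measure has_poisson_density_def)
qed auto

text \<open>Poisson splitting: the weight of \<open>m + j\<close> points, of which the binomial law
  keeps \<open>j\<close>, factors into a Poisson weight of mean \<open>(1 - a) * T\<close> at
  \<open>m\<close> and one of mean \<open>a * T\<close> at \<open>j\<close>.\<close>

lemma thinning_density:
  assumes M: "prob_space M" "X \<in> M \<rightarrow>\<^sub>M count_space UNIV" and f: "has_poisson_density M X T f"
    and pos: "\<And>k. f k \<ge> 0" and T: "T > 0" and a: "0 < a" "a < 1"
  shows "has_poisson_density (thinning_space M a) (thinning X) (a * T)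
    (\<lambda>j. measure_pmf.expectation (poisson_pmf ((1 - a) * T)) (\<lambda>m. f (j + m)))"
  unfolding has_poisson_density_def
proof
  fix j
  interpret M: prob_space M by fact
  interpret D: prob_space "density (measure_pmf (poisson_pmf T)) f"
    using M f pos by (simp add: M.prob_space_distr flip: distr_eq_density_poisson)
  have f_int: "integrable (poisson_pmf T) f"
    using D.emeasure_space_1 pos
    by (intro integrableI_nonneg) (auto simp: emeasure_density)
  let ?b = "\<lambda>k. pmf (binomial_pmf k a) j"
  have fb: "integrable (poisson_pmf T) (\<lambda>k. f k * ?b k)"
    by (rule Bochner_Integration.integrable_bound[OF f_int])
       (use pos in \<open>auto simp: abs_mult intro!: mult_left_le pmf_le_1\<close>)
  have "measure (thinning_space M a) {z \<in> space (thinning_space M a). thinning X z = j} =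
      (\<integral>\<omega>. ?b (X \<omega>) \<partial>M)"
    using M a by (intro measure_thinning_eq) auto
  also have "\<dots> = (\<integral>k. ?b k \<partial>distr M (count_space UNIV) X)"
    using M by (simp add: integral_distr)
  also have "\<dots> = measure_pmf.expectation (poisson_pmf T) (\<lambda>k. f k * ?b k)"
    using pos by (simp add: distr_eq_density_poisson[OF M f pos] integral_density)
  also have "\<dots> = measure_pmf.expectation (poisson_pmf ((1 - a) * T)) (\<lambda>m. f (j + m)) * pmf (poisson_pmf (a * T)) j"
  proof (rule sums_unique2)
    let ?r = "\<lambda>k. pmf (poisson_pmf T) k * (f k * ?b k)"
    show "?r sums measure_pmf.expectation (poisson_pmf T) (\<lambda>k. f k * ?b k)"
      by (rule sums_pmf_expectation[OF fb])
    have r: "?r (m + j) = pmf (poisson_pmf ((1 - a) * T)) m * f (j + m) * pmf (poisson_pmf (a * T)) j" for m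
    proof -
      have "exp (- T) = exp (- ((1 - a) * T)) * exp (- (a * T))"
        by (simp add: mult_exp_exp algebra_simps)
      moreover have "T ^ (m + j) * a ^ j * (1 - a) ^ m = ((1 - a) * T) ^ m * (a * T) ^ j"
        by (simp add: power_add power_mult_distrib)
      ultimately show ?thesis
        using T a by (simp add: binomial_fact divide_simps add.commute[of j])
    qed
    have "(\<lambda>m. pmf (poisson_pmf ((1 - a) * T)) m * f (j + m)) sums
        measure_pmf.expectation (poisson_pmf ((1 - a) * T)) (\<lambda>m. f (j + m))"
    proof (rule sums_pmf_expectation)
      have "summable (\<lambda>m. ?r (m + j))"
        using sums_pmf_expectation[OF fb] by (intro summable_ignore_initial_segment) (rule sums_summable)
      then have "summable (\<lambda>m. pmf (poisson_pmf ((1 - a) * T)) m * f (j + m))"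
        unfolding r mult.commute[of _ "pmf (poisson_pmf (a * T)) j"] summable_cmult_iff
        using T a by (simp add: mult.commute)
      then show "integrable (poisson_pmf ((1 - a) * T)) (\<lambda>m. f (j + m))"
        using pos by (simp add: integrable_pmf_nat_iff abs_mult)
    qed
    from sums_mult2[OF this, of "pmf (poisson_pmf (a * T)) j"]
    have "(\<lambda>m. ?r (m + j)) sums (measure_pmf.expectation (poisson_pmf ((1 - a) * T)) (\<lambda>m. f (j + m)) *
        pmf (poisson_pmf (a * T)) j)"
      unfolding r .
    \<comment> \<open>The terms with \<open>k < j\<close> vanish, since \<open>k\<close> trials
      cannot give \<open>j\<close> successes, so the shifted series has the same sum.\<close>
    then show "?r sums (measure_pmf.expectation (poisson_pmf ((1 - a) * T)) (\<lambda>m. f (j + m)) *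
        pmf (poisson_pmf (a * T)) j)"
      using a by (subst (asm) sums_zero_iff_shift) auto
  qed
  finally show "measure (thinning_space M a) {z \<in> space (thinning_space M a). thinning X z = j} =
      measure_pmf.expectation (poisson_pmf ((1 - a) * T)) (\<lambda>m. f (j + m)) * pmf (poisson_pmf (a * T)) j" .
qed

text \<open>\<open>rel_entropy\<close> asks for plain summability, a Bochner integral for absolute
  summability. They agree because \<open>x ln x\<close> is bounded below and the Poisson weights are
  summable.\<close>

lemma rel_entropy_eq:
  assumes "t > 0" "has_poisson_density M Y t g" "\<And>k. g k > 0" "integrable (poisson_pmf t) g"
  shows "rel_entropy M Y t = (if integrable (poisson_pmf t) (\<lambda>k. g k * ln (g k))
    then ereal (measure_pmf.expectation (poisson_pmf t) (\<lambda>k. g k * ln (g k))) else \<infinity>)"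
proof -
  let ?h = "\<lambda>k. pmf (poisson_pmf t) k * (g k * ln (g k))"
  have g: "poisson_density M Y t = g"
    using assms by (simp add: has_poisson_density_iff)
  have "summable ?h \<longleftrightarrow> summable (\<lambda>k. \<bar>?h k\<bar>)"
  proof
    assume "summable ?h"
    moreover have "summable (\<lambda>k. pmf (poisson_pmf t) k * 1)"
      by (rule sums_summable[OF sums_pmf_expectation]) simp
    ultimately have dom: "summable (\<lambda>k. ?h k + 2 * pmf (poisson_pmf t) k)"
      by (intro summable_add summable_mult) simp_all
    \<comment> \<open>Since \<open>g k * ln (g k) \<ge> g k - 1 > -1\<close>, its absolute value
      exceeds it by less than 2.\<close>
    have le: "\<bar>?h k\<bar> \<le> ?h k + 2 * pmf (poisson_pmf t) k" for k
    proof -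
      have "g k * ln (g k) \<ge> g k - 1" using assms by (intro xlnx_ge)
      then have "\<bar>g k * ln (g k)\<bar> \<le> g k * ln (g k) + 2" using assms(3)[of k] by linarith
      then have "pmf (poisson_pmf t) k * \<bar>g k * ln (g k)\<bar> \<le> pmf (poisson_pmf t) k * (g k * ln (g k) + 2)"
        by (rule mult_left_mono) simp
      then show ?thesis by (simp add: abs_mult algebra_simps del: pmf_poisson)
    qed
    show "summable (\<lambda>k. \<bar>?h k\<bar>)"
      by (rule summable_comparison_test'[OF dom]) (use le in \<open>simp only: real_norm_def abs_idempotent\<close>)
  qed (rule summable_rabs_cancel)
  then have "summable ?h \<longleftrightarrow> integrable (poisson_pmf t) (\<lambda>k. g k * ln (g k))"
    unfolding integrable_pmf_nat_iff .
  then show ?thesis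
    using sums_pmf_expectation[of "poisson_pmf t" "\<lambda>k. g k * ln (g k)"]
    by (simp add: rel_entropy_def Let_def g mult.commute[of _ "pmf _ _"] sums_iff del: pmf_poisson)
qed

subsection \<open>Convexity of the entropy in the thinning parameter\<close>

text \<open>By \<open>thinning_density\<close>, if \<open>h\<close> is the density of
  \<open>X\<close> and \<open>0 < a < 1\<close>, then \<open>t = (1 - a) * T\<close> gives the
  density of the \<open>a\<close>-thinning.\<close>

definition poisson_avg :: "real \<Rightarrow> (nat \<Rightarrow> real) \<Rightarrow> nat \<Rightarrow> real" where
  "poisson_avg t h j = measure_pmf.expectation (poisson t) (\<lambda>m. h (j + m))"

definition poisson_ent :: "real \<Rightarrow> (nat \<Rightarrow> real) \<Rightarrow> real" where
  "poisson_ent t h = measure_pmf.expectation (poisson t) (\<lambda>k. h k * ln (h k))"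

text \<open>The mass is left free so that the shifts \<open>k \<mapsto> h (u + k)\<close>, whose
  mass varies with \<open>u\<close>, can qualify as well.\<close>

definition ent_density :: "real \<Rightarrow> (nat \<Rightarrow> real) \<Rightarrow> bool" where
  "ent_density t h \<longleftrightarrow> integrable (poisson t) h \<and> integrable (poisson t) (\<lambda>k. h k * ln (h k)) \<and>
     (\<forall>k. h k > 0)"

lemma poisson_ent_cong:
  "(\<And>k. k \<in> set_pmf (poisson t) \<Longrightarrow> g k = h k) \<Longrightarrow> poisson_ent t g = poisson_ent t h"
  unfolding poisson_ent_def by (intro integral_cong_AE) (auto simp: AE_measure_pmf_iff)

lemma poisson_avg_0: "poisson_avg 0 h = h"
  by (simp add: poisson_avg_def poisson_0 fun_eq_iff)

text \<open>Semigroup property: two successive thinnings amount to one. At the atoms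
  \<open>u\<close> of \<open>poisson r\<close> the shifted \<open>h\<close> is known to be
  integrable.\<close>

lemma poisson_avg_avg:
  assumes "r \<ge> 0" "s \<ge> 0" "t \<ge> 0" "integrable (poisson (r + s + t)) h" "u \<in> set_pmf (poisson r)"
  shows "poisson_avg s (poisson_avg t h) u = poisson_avg (s + t) h u"
proof -
  have "integrable (poisson (s + t)) (\<lambda>v. h (u + v))"
    using assms by (intro integrable_poisson_shift[of r]) (auto simp: add.assoc)
  from integral_poisson_avg[OF assms(2,3) this] show ?thesis
    by (simp add: poisson_avg_def add.assoc)
qed

context
  fixes s t :: real and h :: "nat \<Rightarrow> real"
  assumes st: "s \<ge> 0" "t \<ge> 0" and h: "ent_density (s + t) h"
begin

interpretation P: pair_prob_space "poisson s" "poisson t" by (rule pair_prob_space_pmf)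

lemma ent_density_pair:
  "integrable (poisson s \<Otimes>\<^sub>M poisson t) (\<lambda>(u, v). h (u + v))"
  "integrable (poisson s \<Otimes>\<^sub>M poisson t) (\<lambda>z. (\<lambda>(u, v). h (u + v)) z * ln ((\<lambda>(u, v). h (u + v)) z))"
  "(\<lambda>(u, v). h (u + v)) z > 0"
  using h st integrable_poisson_add[of s t h] integrable_poisson_add[of s t "\<lambda>k. h k * ln (h k)"]
  by (auto simp: ent_density_def case_prod_unfold)

lemma integral_xlnx_pair:
  "(\<integral>z. (\<lambda>(u, v). h (u + v)) z * ln ((\<lambda>(u, v). h (u + v)) z) \<partial>(poisson s \<Otimes>\<^sub>M poisson t)) = poisson_ent (s + t) h"
  using integral_poisson_add[OF st, of "\<lambda>k. h k * ln (h k)"]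
  by (simp add: poisson_ent_def case_prod_unfold)

lemma poisson_avg_pos: "u \<in> set_pmf (poisson s) \<Longrightarrow> poisson_avg t h u > 0"
  using h st unfolding poisson_avg_def ent_density_def
  by (intro measure_pmf.expectation_pos integrable_poisson_shift) auto

lemma integrable_poisson_avg_xlnx: "integrable (poisson s) (\<lambda>u. poisson_avg t h u * ln (poisson_avg t h u))"
  using P.integrable_xlnx_marginal[OF ent_density_pair] by (simp add: poisson_avg_def)

lemma poisson_ent_avg_le: "poisson_ent s (poisson_avg t h) \<le> poisson_ent (s + t) h"
  using P.xlnx_marginal_le[OF ent_density_pair] unfolding integral_xlnx_pair
  by (simp add: poisson_avg_def poisson_ent_def)

lemma ent_density_avg: "s > 0 \<Longrightarrow> ent_density s (poisson_avg t h)"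
  using h st integrable_poisson_avg_xlnx poisson_avg_pos integrable_poisson_avg[of s t h]
  by (simp add: ent_density_def set_poisson poisson_avg_def[abs_def])

text \<open>\<open>xlnx_superadditive\<close> for \<open>F (u, v) = h (u + v)\<close>: both
  marginals are Poisson averages, and the total mass is
  \<open>poisson_avg (s + t) h 0\<close>.\<close>

lemma
  shows poisson_ent_superadditive:
      "poisson_ent s (poisson_avg t h) + poisson_ent t (poisson_avg s h) \<le>
       poisson_ent (s + t) h + poisson_avg (s + t) h 0 * ln (poisson_avg (s + t) h 0)"
    and poisson_ent_superadditive_eq_iff:
      "poisson_ent s (poisson_avg t h) + poisson_ent t (poisson_avg s h) =
       poisson_ent (s + t) h + poisson_avg (s + t) h 0 * ln (poisson_avg (s + t) h 0) \<longleftrightarrow>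
       (\<forall>u\<in>set_pmf (poisson s). \<forall>v\<in>set_pmf (poisson t).
         h (u + v) * poisson_avg (s + t) h 0 = poisson_avg t h u * poisson_avg s h v)"
proof -
  have m: "(\<integral>z. (\<lambda>(u, v). h (u + v)) z \<partial>(poisson s \<Otimes>\<^sub>M poisson t)) = poisson_avg (s + t) h 0"
    using integral_poisson_add[OF st] by (simp add: poisson_avg_def)
  have G: "(\<integral>v. (\<lambda>(u, v). h (u + v)) (k, v) \<partial>poisson t) = poisson_avg t h k"
    "(\<integral>u. (\<lambda>(u, v). h (u + v)) (u, k) \<partial>poisson s) = poisson_avg s h k" for k
    by (simp_all add: poisson_avg_def add.commute)
  note sup = P.xlnx_superadditive[OF ent_density_pair] P.xlnx_superadditive_eq_iff[OF ent_density_pair]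
  show "poisson_ent s (poisson_avg t h) + poisson_ent t (poisson_avg s h) \<le>
       poisson_ent (s + t) h + poisson_avg (s + t) h 0 * ln (poisson_avg (s + t) h 0)"
    using sup(1) unfolding integral_xlnx_pair G m unfolding poisson_ent_def .
  show "poisson_ent s (poisson_avg t h) + poisson_ent t (poisson_avg s h) =
       poisson_ent (s + t) h + poisson_avg (s + t) h 0 * ln (poisson_avg (s + t) h 0) \<longleftrightarrow>
       (\<forall>u\<in>set_pmf (poisson s). \<forall>v\<in>set_pmf (poisson t).
         h (u + v) * poisson_avg (s + t) h 0 = poisson_avg t h u * poisson_avg s h v)"
    using sup(2) unfolding integral_xlnx_pair G m unfolding poisson_ent_def measure_pair_pmf AE_measure_pmf_iff
    by simp
qed

end

text \<open>Superadditivity for the unnormalised densities \<open>k \<mapsto> h (u + k)\<close>, integrated over \<open>u\<close>.\<close>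

lemma poisson_ent_strong_superadditive:
  assumes rst: "r \<ge> 0" "s \<ge> 0" "t \<ge> 0" and h: "ent_density (r + s + t) h"
  shows "poisson_ent (r + s) (poisson_avg t h) + poisson_ent (r + t) (poisson_avg s h) \<le>
    poisson_ent (r + s + t) h + poisson_ent r (poisson_avg (s + t) h)"
proof -
  let ?E = "\<lambda>t g. measure_pmf.expectation (poisson t) g"
  let ?x = "\<lambda>g u. g u * ln (g u :: real)"
  have h': "ent_density (s + t) (\<lambda>k. h (u + k))" if "u \<in> set_pmf (poisson r)" for u
    using h rst that unfolding ent_density_def
    by (auto intro!: integrable_poisson_shift[of r] intro: integrable_poisson_shift[of r "s + t" "?x h"] simp: add.assoc)
  have split: "integrable (poisson r) (\<lambda>u. ?E q (\<lambda>v. ?x g (u + v)))"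
      "?E r (\<lambda>u. ?E q (\<lambda>v. ?x g (u + v))) = poisson_ent (r + q) g"
    if "q \<ge> 0" "integrable (poisson (r + q)) (?x g)" for q g
    using that rst integrable_poisson_avg[of r q "?x g"] integral_poisson_avg[of r q "?x g"]
    by (auto simp: poisson_ent_def)
  have "ent_density (r + t + s) h" using h by (simp add: add_ac)
  then have i: "integrable (poisson (r + s)) (?x (poisson_avg t h))" "integrable (poisson (r + t)) (?x (poisson_avg s h))"
      "integrable (poisson r) (?x (poisson_avg (s + t) h))" "integrable (poisson (r + (s + t))) (?x h)"
    using rst h integrable_poisson_avg_xlnx[of "r + s" t h] integrable_poisson_avg_xlnx[of "r + t" s h]
      integrable_poisson_avg_xlnx[of r "s + t" h]
    by (auto simp: ent_density_def add.assoc)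
  \<comment> \<open>For fixed \<open>u\<close> the shifted density has mass
    \<open>poisson_avg (s + t) h u\<close>, so the term \<open>m ln m\<close> of superadditivity
    averages to an entropy with respect to \<open>poisson r\<close>.\<close>
  have "?E r (\<lambda>u. ?E s (\<lambda>v. ?x (poisson_avg t h) (u + v)) + ?E t (\<lambda>v. ?x (poisson_avg s h) (u + v))) \<le>
      ?E r (\<lambda>u. ?E (s + t) (\<lambda>v. ?x h (u + v)) + ?x (poisson_avg (s + t) h) u)"
  proof (rule integral_mono_AE)
    show "AE u in poisson r. ?E s (\<lambda>v. ?x (poisson_avg t h) (u + v)) + ?E t (\<lambda>v. ?x (poisson_avg s h) (u + v)) \<le>
        ?E (s + t) (\<lambda>v. ?x h (u + v)) + ?x (poisson_avg (s + t) h) u"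
      unfolding AE_measure_pmf_iff
      using poisson_ent_superadditive[OF rst(2,3) h']
      by (auto simp: poisson_ent_def poisson_avg_def add.assoc)
  qed (use i rst in \<open>auto intro!: split\<close>)
  then show ?thesis
    using i rst by (simp add: split add.assoc) (simp add: poisson_ent_def)
qed

text \<open>The excess over a chord, which vanishes at both ends of the chord, is at most half its own
  supremum.\<close>

lemma midpoint_convex_bounded_imp_convex:
  fixes \<phi> :: "'a :: real_vector \<Rightarrow> real"
  assumes S: "convex S" and bdd: "\<And>x. x \<in> S \<Longrightarrow> \<phi> x \<le> K"
    and mid: "\<And>x y. x \<in> S \<Longrightarrow> y \<in> S \<Longrightarrow> 2 * \<phi> ((1 / 2) *\<^sub>R (x + y)) \<le> \<phi> x + \<phi> y"
  shows "convex_on S \<phi>"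
proof (rule convex_onI)
  fix u :: real and x y assume u: "0 < u" "u < 1" and xy: "x \<in> S" "y \<in> S"
  define p where "p v = (1 - v) *\<^sub>R x + v *\<^sub>R y" for v
  define \<psi> where "\<psi> v = \<phi> (p v) - (1 - v) * \<phi> x - v * \<phi> y" for v
  have p: "p v \<in> S" if "v \<in> {0..1}" for v
    using that S xy unfolding p_def by (auto intro: convexD)
  let ?M = "Sup (\<psi> ` {0..1})"
  have "\<psi> v \<le> K + \<bar>\<phi> x\<bar> + \<bar>\<phi> y\<bar>" if "v \<in> {0..1}" for v
  proof -
    have "\<bar>(1 - v) * \<phi> x\<bar> \<le> \<bar>\<phi> x\<bar>" "\<bar>v * \<phi> y\<bar> \<le> \<bar>\<phi> y\<bar>"
      using that by (auto simp: abs_mult intro!: mult_left_le_one_le)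
    then show ?thesis
      using bdd[OF p[OF that]] unfolding \<psi>_def by linarith
  qed
  then have bdd': "bdd_above (\<psi> ` {0..1})" by (rule bdd_aboveI2)
  then have le: "\<psi> v \<le> ?M" if "v \<in> {0..1}" for v
    using that by (auto intro: cSup_upper)
  have ends: "\<psi> 0 = 0" "\<psi> 1 = 0" by (auto simp: \<psi>_def p_def)
  have mid': "2 * \<psi> ((v + w) / 2) \<le> \<psi> v + \<psi> w" if "v \<in> {0..1}" "w \<in> {0..1}" for v w
  proof -
    have "p ((v + w) / 2) = (1 / 2) *\<^sub>R (p v + p w)"
      by (simp add: p_def algebra_simps add_divide_distrib flip: scaleR_add_left)
    then show ?thesis
      using mid[OF p p, OF that] by (simp add: \<psi>_def field_simps)
  qed
  \<comment> \<open>\<open>v\<close> is the midpoint of its nearer endpoint, where the excess is 0,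
    and another point of \<open>{0..1}\<close>, where it is at most \<open>?M\<close>.\<close>
  have "\<psi> v \<le> ?M / 2" if "v \<in> {0..1}" for v
  proof (cases "v \<le> 1 / 2")
    case True
    then show ?thesis using mid'[of 0 "2 * v"] le[of "2 * v"] that ends by auto
  next
    case False
    then show ?thesis using mid'[of 1 "2 * v - 1"] le[of "2 * v - 1"] that ends by auto
  qed
  then have "?M \<le> ?M / 2" by (intro cSup_least) auto
  then have "\<psi> u \<le> 0" using le[of u] u by auto
  then show "\<phi> ((1 - u) *\<^sub>R x + u *\<^sub>R y) \<le> (1 - u) * \<phi> x + u * \<phi> y"
    by (simp add: \<psi>_def p_def)
qed (rule S)

text \<open>A convex function that meets its chord at an interior point coincides with it. For the
  value at 1/2, convexity is used on the half of the interval that contains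
  \<open>a\<close>.\<close>

lemma convex_on_half_eq:
  fixes \<phi> :: "real \<Rightarrow> real"
  assumes conv: "convex_on {0..1} \<phi>" and "\<phi> 0 = 0" and a: "0 < a" "a < 1" and eq: "\<phi> a = a * \<phi> 1"
  shows "2 * \<phi> (1 / 2) = \<phi> 1"
proof (rule antisym)
  show "2 * \<phi> (1 / 2) \<le> \<phi> 1"
    using convex_onD[OF conv, of "1 / 2" 0 1] assms(2) by simp
  show "\<phi> 1 \<le> 2 * \<phi> (1 / 2)"
  proof (cases "a \<le> 1 / 2")
    case True
    have "a * \<phi> 1 \<le> a * (2 * \<phi> (1 / 2))"
      using convex_onD[OF conv, of "2 * a" 0 "1 / 2"] assms(2) a eq True by simp
    then show ?thesis using a by simp
  next
    case False
    have "a * \<phi> 1 \<le> (2 - 2 * a) * \<phi> (1 / 2) + (2 * a - 1) * \<phi> 1"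
      using convex_onD[OF conv, of "2 * a - 1" "1 / 2" 1] a eq False by (simp add: algebra_simps)
    then have "(1 - a) * \<phi> 1 \<le> (1 - a) * (2 * \<phi> (1 / 2))" by (simp add: algebra_simps)
    then show ?thesis using a by simp
  qed
qed

text \<open>Midpoint convexity is \<open>poisson_ent_strong_superadditive\<close> for the density of
  the \<open>y\<close>-thinning, with \<open>r = x * T\<close> and \<open>s = t = b * T\<close>,
  where \<open>b\<close> is half the gap from \<open>x\<close> to \<open>y\<close>. The uniform
  bound is Jensen's inequality.\<close>

lemma convex_on_poisson_ent:
  assumes T: "T > 0" and f: "ent_density T f"
  shows "convex_on {0..1} (\<lambda>a. poisson_ent (a * T) (poisson_avg ((1 - a) * T) f))"
    (is "convex_on _ ?\<phi>")
proof (rule midpoint_convex_bounded_imp_convex)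
  have T_eq: "T = a * T + (1 - a) * T" for a by (simp add: algebra_simps)
  fix x :: real assume x: "x \<in> {0..1}"
  show "?\<phi> x \<le> poisson_ent T f"
    using poisson_ent_avg_le[of "x * T" "(1 - x) * T" f] x T f by (simp flip: T_eq)
  fix y :: real assume y: "y \<in> {0..1}"
  show "2 * ?\<phi> ((1 / 2) *\<^sub>R (x + y)) \<le> ?\<phi> x + ?\<phi> y"
    using x y
  proof (induction x y rule: linorder_wlog)
    case (sym x y)
    then show ?case by (simp add: add.commute)
  next
    case (le x y)
    show ?case
    proof (cases "y = 0")
      \<comment> \<open>Here \<open>x = y = 0\<close>; the case is separated because
        \<open>ent_density_avg\<close> requires a positive mean \<open>y * T\<close>.\<close>
      case True
      then show ?thesis using le by simp
    next
      case False
      define b where "b = (y - x) / 2"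
      let ?g = "poisson_avg ((1 - y) * T) f"
      have b: "b \<ge> 0" "y = x + b + b" using le by (auto simp: b_def)
      \<comment> \<open>Thinning in two stages: averaging the density of the
        \<open>y\<close>-thinning with mean \<open>c * T\<close> yields that of the
        \<open>(y - c)\<close>-thinning.\<close>
      have avg: "poisson_avg (c * T) ?g k = poisson_avg ((1 - (y - c)) * T) f k"
        if "0 \<le> c" "c \<le> y" "k \<in> set_pmf (poisson ((y - c) * T))" for c k
      proof -
        have "(y - c) * T + c * T + (1 - y) * T = T" "c * T + (1 - y) * T = (1 - (y - c)) * T"
          by (simp_all add: algebra_simps)
        then show ?thesis
          using poisson_avg_avg[of "(y - c) * T" "c * T" "(1 - y) * T" f k] that T f le
          by (simp add: ent_density_def)
      qed
      have "ent_density (y * T + (1 - y) * T) f"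
        using f by (simp flip: T_eq)
      then have "ent_density (y * T) ?g"
        using le T False by (intro ent_density_avg) auto
      then have "poisson_ent (x * T + b * T) (poisson_avg (b * T) ?g) + poisson_ent (x * T + b * T) (poisson_avg (b * T) ?g) \<le>
          poisson_ent (x * T + b * T + b * T) ?g + poisson_ent (x * T) (poisson_avg (b * T + b * T) ?g)"
        using le T b by (intro poisson_ent_strong_superadditive) (auto simp: algebra_simps)
      moreover have e1: "poisson_ent (x * T + b * T) (poisson_avg (b * T) ?g) = ?\<phi> (x + b)"
        using avg[of b] b le by (auto simp: algebra_simps intro!: poisson_ent_cong)
      moreover have e2: "poisson_ent (x * T) (poisson_avg (b * T + b * T) ?g) = ?\<phi> x"
        using avg[of "b + b"] b le by (auto simp: algebra_simps intro!: poisson_ent_cong)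
      moreover have e3: "x * T + b * T + b * T = y * T"
        using b by (simp add: algebra_simps)
      ultimately have "2 * ?\<phi> (x + b) \<le> ?\<phi> x + ?\<phi> y"
        unfolding e1 e2 e3 by linarith
      moreover have "(1 / 2) *\<^sub>R (x + y) = x + b" using b by simp
      ultimately show ?thesis by metis
    qed
  qed
qed simp

section \<open>The equality case at the parameter 1/2\<close>

text \<open>Since \<open>f\<close> has mass 1 the term \<open>m ln m\<close> vanishes, and equality
  in superadditivity becomes a multiplicative functional equation for \<open>f\<close>.\<close>

lemma poisson_ent_half_iff:
  assumes T: "T > 0" and f: "ent_density T f" and f1: "measure_pmf.expectation (poisson T) f = 1"
  shows "2 * poisson_ent (T / 2) (poisson_avg (T / 2) f) = poisson_ent T f \<longleftrightarrow>
    (\<exists>\<beta> \<gamma>. \<forall>k. f k = exp (\<beta> * real k + \<gamma>))"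
proof -
  let ?g = "poisson_avg (T / 2) f"
  have pos: "?g u > 0" for u
    using T f poisson_avg_pos[of "T / 2" "T / 2" f u] by (simp add: set_poisson)
  have "poisson_avg T f 0 = 1" using f1 by (simp add: poisson_avg_def)
  then have "2 * poisson_ent (T / 2) ?g = poisson_ent T f \<longleftrightarrow> (\<forall>u v. f (u + v) = ?g u * ?g v)"
    using poisson_ent_superadditive_eq_iff[of "T / 2" "T / 2" f] T f by (simp add: set_poisson)
  also have "\<dots> \<longleftrightarrow> (\<exists>\<beta> \<gamma>. \<forall>k. f k = exp (\<beta> * real k + \<gamma>))"
  proof safe
    assume *: "\<forall>u v. f (u + v) = ?g u * ?g v"
    \<comment> \<open>The functional equation at \<open>v = 1\<close> and \<open>v = 0\<close> shows
      that \<open>f\<close> has the constant successive ratio \<open>?g 1 / ?g 0\<close>.\<close>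
    have "f k = exp (ln (?g 1 / ?g 0) * real k + ln (f 0))" for k
    proof (induction k)
      case (Suc k)
      have "f (Suc k) = f k * (?g 1 / ?g 0)"
        using *[rule_format, of k 1] *[rule_format, of k 0] pos[of 0] by simp
      also have "\<dots> = exp (ln (?g 1 / ?g 0) * real (Suc k) + ln (f 0))"
        using Suc pos[of 0] pos[of 1] by (simp add: exp_add algebra_simps)
      finally show ?case .
    qed (use f in \<open>simp add: ent_density_def\<close>)
    then show "\<exists>\<beta> \<gamma>. \<forall>k. f k = exp (\<beta> * real k + \<gamma>)" by blast
  next
    fix \<beta> \<gamma> u v assume *: "\<forall>k. f k = exp (\<beta> * real k + \<gamma>)"
    let ?c = "measure_pmf.expectation (poisson (T / 2)) (\<lambda>k. exp (\<beta> * real k))"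
    have g: "?g k = exp (\<beta> * real k) * (exp \<gamma> * ?c)" for k
      unfolding poisson_avg_def using * by (simp add: exp_add algebra_simps)
    \<comment> \<open>For log-linear \<open>f\<close>, \<open>?g u * ?g v\<close> is
      \<open>f (u + v)\<close> times \<open>exp \<gamma> * ?c * ?c\<close>; this factor is the mean
      of \<open>?g\<close>, hence 1.\<close>
    have "measure_pmf.expectation (poisson (T / 2)) ?g = 1"
      using integral_poisson_avg[of "T / 2" "T / 2" f] T f f1
      unfolding poisson_avg_def ent_density_def by simp
    then have "exp \<gamma> * ?c * ?c = 1" unfolding g by (simp add: mult_ac)
    then have "exp (\<beta> * real (u + v) + \<gamma>) = exp (\<beta> * real (u + v) + \<gamma>) * (exp \<gamma> * ?c * ?c)" by simp
    then show "f (u + v) = ?g u * ?g v"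
      unfolding g *[rule_format, of "u + v"] by (simp add: exp_add algebra_simps)
  qed
  finally show ?thesis .
qed

section \<open>Entropy equality for thinnings and the Poisson law\<close>

theorem proposition3p22:
  fixes M :: "'w measure" and X :: "'w \<Rightarrow> nat" and f :: "nat \<Rightarrow> real" and T :: real
  assumes "prob_space M"
    and "X \<in> M \<rightarrow>\<^sub>M count_space UNIV"
    and "T > 0"
    and "\<And>k. f k > 0"
    and "has_poisson_density M X T f"
    and "rel_entropy M X T < \<infinity>"
  shows "((\<exists>a::real. 0 < a \<and> a < 1 \<and>
             rel_entropy (thinning_space M a) (thinning X) (a * T) = ereal a * rel_entropy M X T)
           \<longleftrightarrow> (\<exists>\<beta> \<gamma> :: real. \<forall>k. f k = exp (\<beta> * real k + \<gamma>)))
       \<and> ((\<exists>\<beta> \<gamma> :: real. \<forall>k. f k = exp (\<beta> * real k + \<gamma>))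
           \<longleftrightarrow> (\<exists>r>0. distr M (count_space UNIV) X = measure_pmf (poisson_pmf r)))"
proof -
  note M = assms(1,2) and T = assms(3) and pos = assms(4) and dens = assms(5)
  interpret M: prob_space M by fact
  have nonneg: "f k \<ge> 0" for k using pos by (simp add: less_imp_le)
  have law: "distr M (count_space UNIV) X = density (measure_pmf (poisson_pmf T)) f"
    using M dens nonneg by (rule distr_eq_density_poisson)
  interpret D: prob_space "density (measure_pmf (poisson_pmf T)) f"
    using M by (simp add: M.prob_space_distr flip: law)
  have nn: "(\<integral>\<^sup>+k. ennreal (f k) \<partial>poisson_pmf T) = 1"
    using D.emeasure_space_1 by (simp add: emeasure_density)
  have f_int: "integrable (poisson_pmf T) f"
    using nn nonneg by (intro integrableI_nonneg) auto
  have f1: "measure_pmf.expectation (poisson T) f = 1"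
    using T nonneg nn by (simp add: poisson_def integral_eq_nn_integral)
  have f: "ent_density T f" and HX: "rel_entropy M X T = ereal (poisson_ent T f)"
    using assms(6) rel_entropy_eq[OF T dens pos f_int] f_int T pos
    by (auto simp: ent_density_def poisson_def poisson_ent_def split: if_splits)
  \<comment> \<open>The formula also makes sense at \<open>a = 0\<close> and \<open>a = 1\<close>,
    so convexity can be used on the closed interval.\<close>
  define \<phi> where "\<phi> a = poisson_ent (a * T) (poisson_avg ((1 - a) * T) f)" for a
  have \<phi>1: "\<phi> 1 = poisson_ent T f" by (simp add: \<phi>_def poisson_avg_0)
  have HTX: "rel_entropy (thinning_space M a) (thinning X) (a * T) = ereal (\<phi> a)" if a: "0 < a" "a < 1" for a
  proof -
    let ?g = "poisson_avg ((1 - a) * T) f"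
    have "a * T + (1 - a) * T = T" by (simp add: algebra_simps)
    then have "ent_density (a * T) ?g"
      using ent_density_avg[of "a * T" "(1 - a) * T" f] f a T by simp
    moreover have "has_poisson_density (thinning_space M a) (thinning X) (a * T) ?g"
      using thinning_density[OF M dens nonneg T a] a T by (simp add: poisson_avg_def[abs_def] poisson_def)
    ultimately show ?thesis
      using a T by (subst rel_entropy_eq[of _ _ _ ?g]) (auto simp: \<phi>_def ent_density_def poisson_ent_def poisson_def)
  qed
  have half: "2 * \<phi> (1 / 2) = \<phi> 1 \<longleftrightarrow> (\<exists>\<beta> \<gamma>. \<forall>k. f k = exp (\<beta> * real k + \<gamma>))"
    using poisson_ent_half_iff[OF T f f1] unfolding \<phi>1 by (simp add: \<phi>_def)
  \<comment> \<open>\<open>poisson 0\<close> is the point mass at 0, where the averaged density is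
    the mean of \<open>f\<close>, namely 1.\<close>
  have \<phi>0: "\<phi> 0 = 0"
    using f1 by (simp add: \<phi>_def poisson_ent_def poisson_0 poisson_avg_def)
  have conv: "convex_on {0..1} \<phi>"
    using convex_on_poisson_ent[OF T f] unfolding \<phi>_def .
  have "(\<exists>a. 0 < a \<and> a < 1 \<and>
      rel_entropy (thinning_space M a) (thinning X) (a * T) = ereal a * rel_entropy M X T) \<longleftrightarrow>
      (\<exists>a. 0 < a \<and> a < 1 \<and> \<phi> a = a * \<phi> 1)"
    using HTX by (auto simp: HX \<phi>1)
  also have "\<dots> \<longleftrightarrow> 2 * \<phi> (1 / 2) = \<phi> 1"
    using convex_on_half_eq[OF conv \<phi>0] by (auto intro!: exI[of _ "1 / 2"])
  finally have first: "(\<exists>a. 0 < a \<and> a < 1 \<and>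
      rel_entropy (thinning_space M a) (thinning X) (a * T) = ereal a * rel_entropy M X T) \<longleftrightarrow>
      (\<exists>\<beta> \<gamma>. \<forall>k. f k = exp (\<beta> * real k + \<gamma>))"
    unfolding half .
  have poisson_iff: "distr M (count_space UNIV) X = measure_pmf p \<longleftrightarrow>
      (\<forall>k. f k * pmf (poisson_pmf T) k = pmf p k)" for p
  proof -
    have "emeasure (density (poisson_pmf T) f) {k} = ennreal (f k * pmf (poisson_pmf T) k)" for k
      using nonneg by (simp add: emeasure_density ennreal_mult emeasure_pmf_single nn_integral_cmult_indicator)
    then have "distr M (count_space UNIV) X = measure_pmf p \<longleftrightarrow>
        (\<forall>k. ennreal (f k * pmf (poisson_pmf T) k) = ennreal (pmf p k))"
      unfolding law by (auto simp: emeasure_pmf_single intro!: measure_eqI_countable[where A = UNIV])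
    then show ?thesis using nonneg by (simp add: ennreal_inj del: pmf_poisson)
  qed
  have second: "(\<exists>\<beta> \<gamma>. \<forall>k. f k = exp (\<beta> * real k + \<gamma>)) \<longleftrightarrow>
      (\<exists>r>0. distr M (count_space UNIV) X = measure_pmf (poisson_pmf r))"
  proof safe
    fix \<beta> \<gamma> assume *: "\<forall>k. f k = exp (\<beta> * real k + \<gamma>)"
    \<comment> \<open>Exponential tilting by \<open>\<beta>\<close> turns the mean \<open>T\<close>
      into \<open>T * exp \<beta>\<close>. The remaining constant \<open>C\<close> is 1 because both
      laws have total mass 1.\<close>
    define r where "r = T * exp \<beta>"
    define C where "C = exp (\<gamma> - T + r)"
    have r: "r > 0" using T by (simp add: r_def)
    have eq: "f k * pmf (poisson_pmf T) k = C * pmf (poisson_pmf r) k" for k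
      using T r * by (simp add: C_def r_def power_mult_distrib exp_add exp_diff exp_minus exp_of_nat2_mult field_simps)
    have "(\<lambda>k. pmf (poisson_pmf T) k * f k) sums 1"
      using sums_pmf_expectation[OF f_int] f1 T by (simp add: poisson_def)
    moreover have "(\<lambda>k. C * (pmf (poisson_pmf r) k * 1)) sums (C * 1)"
      using sums_pmf_expectation[of "poisson_pmf r" "\<lambda>_. 1"] by (intro sums_mult) simp
    ultimately have "C = 1"
      using eq by (simp add: mult.commute[of _ "f _"] sums_unique2 del: pmf_poisson)
    then show "\<exists>r>0. distr M (count_space UNIV) X = measure_pmf (poisson_pmf r)"
      using r eq by (auto simp: poisson_iff simp del: pmf_poisson)
  next
    fix r :: real assume r: "r > 0" and "distr M (count_space UNIV) X = measure_pmf (poisson_pmf r)"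
    then have eq: "f k * pmf (poisson_pmf T) k = pmf (poisson_pmf r) k" for k
      by (simp add: poisson_iff del: pmf_poisson)
    \<comment> \<open>The quotient of the two Poisson weights is
      \<open>(r / T) ^ k * exp (T - r)\<close>, which dictates both witnesses.\<close>
    have "f k = exp (ln (r / T) * real k + (T - r))" for k
      using eq[of k] r T
      by (simp add: exp_add exp_of_nat2_mult) (simp add: exp_diff exp_minus power_divide field_simps)
    then show "\<exists>\<beta> \<gamma>. \<forall>k. f k = exp (\<beta> * real k + \<gamma>)" by blast
  qed
  show ?thesis using first second by blast
qed

end
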